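(* Let $X\in\mathbb{R}^{n\times p}$, $\beta^0\in\mathbb{R}^p$ and $\lambda>0$. Let $S=\{j:\beta^0_j\ne0\}$ be nonempty, $s=|S|$, let $L\ge1$, and suppose the compatibility constant satisfies $\phi_{comp}(L,S)>0$. If $\beta^\star$ is an optimal solution of the noiseless Lasso problem $$\min_{\beta\in\mathbb{R}^p}\ \Big\{\tfrac1n\|X\beta-X\beta^0\|_2^2+\lambda\|\beta\|_1\Big\},$$ then $\Delta^\star=\beta^\star-\beta^0$ satisfies $$\frac1n\|X\Delta^\star\|_2^2\le\frac{\lambda^2 s}{\phi_{comp}^2(L,S)}\qquad\text{and}\qquad \|\Delta^\star\|_1\le\frac{2\lambda s}{\phi_{comp}^2(L,S)} .$$
   Context: For $\Delta\in\mathbb{R}^p$ and $S\subset\{1,\dots,p\}$, $\Delta_S\in\mathbb{R}^p$ agrees with $\Delta$ on $S$ and is zero outside $S$; $S^c$ is the complement of $S$. $\|\cdot\|_1,\|\cdot\|_2$ are the usual $\ell_1,\ell_2$ norms. The compatibility constant $\phi_{comp}(L,S)\ge0$ is defined, with $s=|S|$, by $$\phi_{comp}^2(L,S)=\min\Big\{\frac{\frac1n\|X\Delta\|_2^2\,s}{\|\Delta_S\|_1^2}:\ \Delta\in\mathbb{R}^p,\ \|\Delta_{S^c}\|_1\le L\|\Delta_S\|_1\ne0\Big\}.$$ *)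

theory Defs
  imports "HOL-Analysis.Analysis"
begin

definition l1_norm :: "real ^ 'p \<Rightarrow> real"
  where "l1_norm x = (\<Sum>j\<in>UNIV. \<bar>x $ j\<bar>)"

definition restrict_vec :: "'p set \<Rightarrow> real ^ 'p \<Rightarrow> real ^ 'p"
  where "restrict_vec S x = (\<chi> j. if j \<in> S then x $ j else 0)"

definition compat_ratio :: "real ^ 'p ^ 'n \<Rightarrow> 'p set \<Rightarrow> real ^ 'p \<Rightarrow> real"
  where "compat_ratio X S \<Delta> =
    (1 / real CARD('n) * (norm (X *v \<Delta>))\<^sup>2 * real (card S)) / (l1_norm (restrict_vec S \<Delta>))\<^sup>2"

definition compat_cone :: "real \<Rightarrow> 'p set \<Rightarrow> (real ^ 'p) set"
  where "compat_cone L S =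
    {\<Delta>. l1_norm (restrict_vec (- S) \<Delta>) \<le> L * l1_norm (restrict_vec S \<Delta>) \<and>
         l1_norm (restrict_vec S \<Delta>) \<noteq> 0}"

text \<open>The infimum below is a minimum whenever \<open>S\<close> is nonempty and \<open>L \<ge> 0\<close>; see
  \<open>phi_comp_attained\<close>.\<close>

definition phi_comp :: "real ^ 'p ^ 'n \<Rightarrow> real \<Rightarrow> 'p set \<Rightarrow> real"
  where "phi_comp X L S = sqrt (INF \<Delta>\<in>compat_cone L S. compat_ratio X S \<Delta>)"

definition noiseless_lasso :: "real ^ 'p ^ 'n \<Rightarrow> real ^ 'p \<Rightarrow> real \<Rightarrow> real ^ 'p \<Rightarrow> real"
  where "noiseless_lasso X \<beta>0 lam \<beta> =
    1 / real CARD('n) * (norm (X *v \<beta> - X *v \<beta>0))\<^sup>2 + lam * l1_norm \<beta>"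

lemma l1_norm_scaleR: "l1_norm (c *\<^sub>R x) = \<bar>c\<bar> * l1_norm x"
  by (simp add: l1_norm_def abs_mult sum_distrib_left)

lemma restrict_vec_scaleR: "restrict_vec S (c *\<^sub>R x) = c *\<^sub>R restrict_vec S x"
  by (simp add: restrict_vec_def vec_eq_iff)

lemma l1_norm_nonneg: "l1_norm x \<ge> 0"
  by (simp add: l1_norm_def sum_nonneg)

lemma l1_norm_restrict: "l1_norm (restrict_vec S x) = (\<Sum>j\<in>S. \<bar>x $ j\<bar>)"
proof -
  have "l1_norm (restrict_vec S x) = (\<Sum>j\<in>UNIV. if j \<in> S then \<bar>x $ j\<bar> else 0)"
    unfolding l1_norm_def restrict_vec_def by (rule sum.cong) auto
  then show ?thesis by (simp add: sum.If_cases)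
qed

lemma norm_le_l1_restrict:
  "norm x \<le> l1_norm (restrict_vec S x) + l1_norm (restrict_vec (- S) x)"
proof -
  have "norm x \<le> (\<Sum>j\<in>UNIV. \<bar>x $ j\<bar>)"
    by (rule norm_le_l1_cart)
  also have "\<dots> = (\<Sum>j\<in>S. \<bar>x $ j\<bar>) + (\<Sum>j\<in>-S. \<bar>x $ j\<bar>)"
    by (subst sum.union_disjoint[symmetric]) auto
  finally show ?thesis by (simp add: l1_norm_restrict)
qed

lemma compat_ratio_scaleR:
  assumes "c \<noteq> 0"
  shows "compat_ratio X S (c *\<^sub>R x) = compat_ratio X S x"
  using assms
  by (simp add: compat_ratio_def restrict_vec_scaleR l1_norm_scaleR power_mult_distrib
      matrix_vector_mult_scaleR)

lemma phi_comp_attained: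
  fixes X :: "real ^ 'p ^ 'n"
  assumes S: "S \<noteq> {}" and L: "L \<ge> 0"
  shows "\<exists>\<Delta>\<in>compat_cone L S. (phi_comp X L S)\<^sup>2 = compat_ratio X S \<Delta> \<and>
    (\<forall>\<Delta>'\<in>compat_cone L S. compat_ratio X S \<Delta> \<le> compat_ratio X S \<Delta>')"
proof -
  define K where "K = {x :: real ^ 'p. (\<Sum>j\<in>S. \<bar>x $ j\<bar>) = 1} \<inter> {x. (\<Sum>j\<in>-S. \<bar>x $ j\<bar>) \<le> L}"
  have "closed K" unfolding K_def
    by (intro closed_Int closed_Collect_eq closed_Collect_le continuous_intros)
  moreover have "bounded K"
    unfolding bounded_iff
  proof (intro exI ballI)
    fix x assume "x \<in> K"
    then show "norm x \<le> 1 + L"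
      using norm_le_l1_restrict[of x S] by (simp add: K_def l1_norm_restrict)
  qed
  ultimately have "compact K" by (simp add: compact_eq_bounded_closed)
  moreover obtain i where i: "i \<in> S" using S by auto
  have e: "\<bar>axis i (1::real) $ j\<bar> = (if i = j then 1 else 0)" for j
    by (simp add: axis_def)
  have "axis i 1 \<in> K"
    using i L by (simp add: K_def e)
  then have "K \<noteq> {}" by auto
  moreover have "continuous_on K (compat_ratio X S)"
    unfolding compat_ratio_def l1_norm_restrict
    by (intro continuous_intros matrix_vector_mult_linear_continuous_on) (auto simp: K_def)
  ultimately obtain m where m: "m \<in> K" "\<forall>y\<in>K. compat_ratio X S m \<le> compat_ratio X S y"
    using continuous_attains_inf by blast
  have mc: "m \<in> compat_cone L S"
    using m(1) by (simp add: K_def compat_cone_def l1_norm_restrict)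
  have le: "compat_ratio X S m \<le> compat_ratio X S y" if y: "y \<in> compat_cone L S" for y
  proof -
    define a where "a = l1_norm (restrict_vec S y)"
    have a: "a > 0" using y l1_norm_nonneg[of "restrict_vec S y"]
      by (simp add: compat_cone_def a_def)
    have "l1_norm (restrict_vec S ((1/a) *\<^sub>R y)) = 1"
      using a by (simp add: restrict_vec_scaleR l1_norm_scaleR flip: a_def)
    moreover have "l1_norm (restrict_vec (- S) ((1/a) *\<^sub>R y)) \<le> L"
      using a y by (simp add: compat_cone_def restrict_vec_scaleR l1_norm_scaleR
          divide_le_eq flip: a_def)
    ultimately have "(1/a) *\<^sub>R y \<in> K" by (simp only: K_def l1_norm_restrict) simp
    then have "compat_ratio X S m \<le> compat_ratio X S ((1/a) *\<^sub>R y)" using m(2) by blast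
    then show ?thesis using a by (simp add: compat_ratio_scaleR)
  qed
  have inf: "(INF y\<in>compat_cone L S. compat_ratio X S y) = compat_ratio X S m"
    by (rule cInf_eq_minimum) (use mc le in auto)
  have "compat_ratio X S m \<ge> 0"
    by (simp add: compat_ratio_def)
  then show ?thesis
    using mc le inf by (intro bexI[of _ m]) (auto simp: phi_comp_def)
qed

end

theory Submission
  imports Defs
begin

text \<open>Comparing the objective at the minimiser with its value at \<open>\<beta>0\<close> gives the basic
  inequality \<open>Q + lam * b \<le> lam * a\<close>, where \<open>Q\<close> is the prediction error and \<open>a\<close>, \<open>b\<close> are the
  \<open>l1\<close> norms of the error on \<open>S\<close> and off \<open>S\<close>. Hence \<open>b \<le> a\<close>, so the error lies in the cone
  and \<open>\<phi>\<^sup>2 * a\<^sup>2 \<le> Q * s \<le> lam * a * s\<close>. Cancelling \<open>a\<close> bounds \<open>a\<close>, and with it \<open>Q\<close> and \<open>a + b\<close>.\<close>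

lemma l1_norm_split:
  "l1_norm x = l1_norm (restrict_vec S x) + l1_norm (restrict_vec (- S) x)"
  unfolding l1_norm_restrict unfolding l1_norm_def
  by (subst sum.union_disjoint[symmetric]) auto

text \<open>On \<open>S\<close> this is the reverse triangle inequality, coordinate by coordinate;
  off \<open>S\<close> the vector \<open>\<beta>\<close> vanishes, so \<open>\<Delta>\<close>
  contributes its full mass there.\<close>

lemma l1_norm_add_sparse_ge:
  assumes "\<And>j. j \<notin> S \<Longrightarrow> \<beta> $ j = 0"
  shows "l1_norm \<beta> - l1_norm (restrict_vec S \<Delta>) + l1_norm (restrict_vec (- S) \<Delta>)
    \<le> l1_norm (\<beta> + \<Delta>)"
proof -
  have "(\<Sum>j\<in>S. \<bar>\<beta> $ j\<bar>) - (\<Sum>j\<in>S. \<bar>\<Delta> $ j\<bar>) \<le> (\<Sum>j\<in>S. \<bar>\<beta> $ j + \<Delta> $ j\<bar>)"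
    unfolding sum_subtractf[symmetric] by (intro sum_mono) linarith
  moreover have "(\<Sum>j\<in>-S. \<bar>\<beta> $ j + \<Delta> $ j\<bar>) = (\<Sum>j\<in>-S. \<bar>\<Delta> $ j\<bar>)"
    and "(\<Sum>j\<in>-S. \<bar>\<beta> $ j\<bar>) = 0"
    using assms by simp_all
  ultimately show ?thesis
    using l1_norm_split[of \<beta> S] l1_norm_split[of "\<beta> + \<Delta>" S]
    by (simp add: l1_norm_restrict)
qed

text \<open>Without noise the quadratic term is zero at \<open>\<beta>0\<close>, so the objective
  there is just \<open>lam * l1_norm \<beta>0\<close>; this term cancels once
  \<open>l1_norm \<beta>\<close> is bounded below by sparsity.\<close>

lemma noiseless_lasso_basic_inequality:
  fixes X :: "real ^ 'p ^ 'n"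
  assumes "lam \<ge> 0" and "\<And>j. j \<notin> S \<Longrightarrow> \<beta>0 $ j = 0"
    and "noiseless_lasso X \<beta>0 lam \<beta> \<le> noiseless_lasso X \<beta>0 lam \<beta>0"
  shows "1 / real CARD('n) * (norm (X *v (\<beta> - \<beta>0)))\<^sup>2
      + lam * l1_norm (restrict_vec (- S) (\<beta> - \<beta>0))
    \<le> lam * l1_norm (restrict_vec S (\<beta> - \<beta>0))"
proof -
  have "lam * (l1_norm \<beta>0 - l1_norm (restrict_vec S (\<beta> - \<beta>0))
      + l1_norm (restrict_vec (- S) (\<beta> - \<beta>0))) \<le> lam * l1_norm \<beta>"
    using l1_norm_add_sparse_ge[of S \<beta>0 "\<beta> - \<beta>0"] assms(1,2)
    by (intro mult_left_mono) auto
  then show ?thesis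
    using assms(3)
    by (simp add: noiseless_lasso_def matrix_vector_mult_diff_distrib algebra_simps)
qed

text \<open>Attainment makes the squared constant the ratio of an actual minimiser over the
  cone.\<close>

lemma phi_comp_le_compat_ratio:
  assumes "S \<noteq> {}" "L \<ge> 0" "\<Delta> \<in> compat_cone L S"
  shows "(phi_comp X L S)\<^sup>2 \<le> compat_ratio X S \<Delta>"
  using phi_comp_attained[OF assms(1,2), of X] assms(3) by auto

theorem theorem4:
  fixes X :: "real ^ 'p ^ 'n"
    and \<beta>0 \<beta>star \<Delta>star :: "real ^ 'p"
    and lam L :: real
    and S :: "'p set"
    and s :: nat
  assumes "lam > 0"
    and "S = {j. \<beta>0 $ j \<noteq> 0}"
    and "S \<noteq> {}"
    and "s = card S"
    and "L \<ge> 1"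
    and "phi_comp X L S > 0"
    and "is_arg_min (noiseless_lasso X \<beta>0 lam) (\<lambda>_. True) \<beta>star"
    and "\<Delta>star = \<beta>star - \<beta>0"
  shows "1 / real CARD('n) * (norm (X *v \<Delta>star))\<^sup>2 \<le> lam\<^sup>2 * real s / (phi_comp X L S)\<^sup>2
    \<and> l1_norm \<Delta>star \<le> 2 * lam * real s / (phi_comp X L S)\<^sup>2"
proof -
  define Q where "Q = 1 / real CARD('n) * (norm (X *v \<Delta>star))\<^sup>2"
  define a where "a = l1_norm (restrict_vec S \<Delta>star)"
  define b where "b = l1_norm (restrict_vec (- S) \<Delta>star)"
  define f where "f = (phi_comp X L S)\<^sup>2"
  have Q: "Q \<ge> 0" by (simp add: Q_def)
  have ab: "a \<ge> 0" "b \<ge> 0" by (simp_all add: a_def b_def l1_norm_nonneg)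
  have f: "f > 0" using assms(6) by (simp add: f_def)
  have "noiseless_lasso X \<beta>0 lam \<beta>star \<le> noiseless_lasso X \<beta>0 lam \<beta>0"
    using assms(7) by (auto simp: is_arg_min_def not_less)
  then have basic: "Q + lam * b \<le> lam * a"
    using noiseless_lasso_basic_inequality[of lam S \<beta>0 X \<beta>star] assms(1,2,8)
    by (simp add: Q_def a_def b_def)
  have "lam * b \<le> lam * a" using basic Q by linarith
  then have ba: "b \<le> a" using assms(1) by simp
  have Qa: "Q \<le> lam * a"
    using basic mult_nonneg_nonneg[of lam b] assms(1) ab by linarith
  \<comment> \<open>The case \<open>a = 0\<close> is split off because the cone excludes vectors
    vanishing on \<open>S\<close>.\<close>
  have a: "a \<le> lam * real s / f"
  proof (cases "a = 0")
    case True
    then show ?thesis using assms(1) f by simp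
  next
    case False
    then have pos: "a > 0" using ab by simp
    \<comment> \<open>Here \<open>L \<ge> 1\<close> enters: the error satisfies the cone condition
      with constant 1, hence also with \<open>L\<close>.\<close>
    have "b \<le> L * a" using ba mult_right_mono[OF assms(5) ab(1)] by simp
    then have "\<Delta>star \<in> compat_cone L S"
      using False by (simp add: compat_cone_def a_def b_def)
    then have "f \<le> Q * real s / a\<^sup>2"
      using phi_comp_le_compat_ratio[of S L \<Delta>star X] assms(3-5)
      by (simp add: compat_ratio_def f_def Q_def a_def)
    then have "f * a\<^sup>2 \<le> Q * real s" using pos by (simp add: pos_le_divide_eq)
    also have "\<dots> \<le> lam * a * real s" using Qa by (intro mult_right_mono) auto
    finally have "a * (a * f) \<le> a * (lam * real s)"
      by (simp add: power2_eq_square mult_ac)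
    then show ?thesis using pos f by (simp add: pos_le_divide_eq)
  qed
  have "Q \<le> lam * (lam * real s / f)"
    using Qa mult_left_mono[OF a, of lam] assms(1) by linarith
  \<comment> \<open>The factor 2 comes from \<open>b \<le> a\<close>.\<close>
  moreover have "a + b \<le> 2 * (lam * real s / f)" using a ba by linarith
  ultimately show ?thesis
    using l1_norm_split[of \<Delta>star S]
    by (simp add: Q_def a_def b_def f_def power2_eq_square mult_ac)
qed

end
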